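(* Let $C\ge0$ be a constant and define $$P^{\mathrm{wo\text{-}rep}}_{\mathrm{distr}}:\quad\min\{\mathbf c^T\mathbf x\mid\mathbf A\mathbf x=\mathbf b,\ 0\le x_j\le C/n\ \text{for all }j\in[n]\}.$$ Let $Q=\{q_1,\dots,q_K\}\subset[n]$ be a set of $K$ indices, $1\le K<n$, sampled uniformly at random from $[n]$ without replacement. Let $\chi$ be an upper bound on $\|\bar{\mathbf c}\|_2$ for every basic solution of the complete problem $P$, where $\bar{\mathbf c}$ is the reduced cost vector of the corresponding basis. For any $\delta\in(0,1)$, with probability at least $1-\delta$, the following implication holds: if $P_Q$ is feasible and $\mathrm{rank}(\mathbf A_Q)=m$, then $$\Delta v(P_Q)\le\Delta v(P^{\mathrm{wo\text{-}rep}}_{\mathrm{distr}})+\frac{C}{\sqrt K}\cdot\chi\cdot\left(\sqrt{\frac{n-K}{n-1}}+\sqrt{\frac{2}{H_{n,K}}\log\frac1\delta}\right),$$ where $$H_{n,K}=\frac{n-1/2}{n-K}\cdot\left(1-\frac{1}{2\max(K,n-K)}\right).$$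
   Context: The complete problem is $P:\ \min\{\mathbf c^T\mathbf x\mid \mathbf A\mathbf x=\mathbf b,\ \mathbf x\ge \mathbf 0\}$ with $\mathbf A\in\mathbb R^{m\times n}$, $\mathbf b\in\mathbb R^m$, $\mathbf c\in\mathbb R^n$. Standing assumptions: $P$ is feasible and bounded, $\mathrm{rank}(\mathbf A)=m$, $\|\mathbf c\|_2=1$. $[n]=\{1,\dots,n\}$. A basis is a set $B\subseteq[n]$ with $|B|=m$ and $\mathbf A_B$ nonsingular. The corresponding basic solution of $P$ (not necessarily feasible) has $\mathbf x_B=\mathbf A_B^{-1}\mathbf b$ and all other components zero, and the reduced cost vector of the basis is $\bar{\mathbf c}=\mathbf c^T-\mathbf c_B^T\mathbf A_B^{-1}\mathbf A$. $\mathbf A_Q$ is the submatrix of $\mathbf A$ with columns indexed by $Q$, $\mathbf c_Q$ the corresponding subvector of $\mathbf c$, and $P_Q:\ \min\{\mathbf c_Q^T\tilde{\mathbf x}\mid\mathbf A_Q\tilde{\mathbf x}=\mathbf b,\ \tilde{\mathbf x}\ge\mathbf 0\}$. $v(\cdot)$ denotes the optimal value, with $v=+\infty$ for an infeasible minimization problem, and $\Delta v(P'')=v(P'')-v(P)$. *)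

theory Defs
  imports "HOL-Analysis.Analysis" "HOL-Probability.Probability"
begin

text \<open>Optimal value of a minimization problem; it is \<open>\<infinity>\<close> when the feasible set is empty.\<close>

definition opt_value :: "('x \<Rightarrow> real) \<Rightarrow> 'x set \<Rightarrow> ereal" where
  "opt_value f S = (INF x\<in>S. ereal (f x))"


subsection \<open>The complete problem and the distribution problem\<close>

definition feas :: "real^'n^'m \<Rightarrow> real^'m \<Rightarrow> (real^'n) set" where
  "feas A b = {x. A *v x = b \<and> (\<forall>j. 0 \<le> x $ j)}"

definition val :: "real^'n^'m \<Rightarrow> real^'m \<Rightarrow> real^'n \<Rightarrow> ereal" where
  "val A b c = opt_value (\<lambda>x. c \<bullet> x) (feas A b)"

definition feas_distr :: "real^'n^'m \<Rightarrow> real^'m \<Rightarrow> real \<Rightarrow> (real^'n) set" where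
  "feas_distr A b C =
     {x. A *v x = b \<and> (\<forall>j. 0 \<le> x $ j \<and> x $ j \<le> C / real CARD('n))}"

definition val_distr :: "real^'n^'m \<Rightarrow> real^'m \<Rightarrow> real^'n \<Rightarrow> real \<Rightarrow> ereal" where
  "val_distr A b c C = opt_value (\<lambda>x. c \<bullet> x) (feas_distr A b C)"


subsection \<open>The restricted problem on a set of columns\<close>

text \<open>A vector of \<open>\<real>\<^sup>Q\<close> is represented by a function on the index type, of which only
  the values on \<open>Q\<close> are used.\<close>

definition cols_mult :: "real^'n^'m \<Rightarrow> 'n set \<Rightarrow> ('n \<Rightarrow> real) \<Rightarrow> real^'m" where
  "cols_mult A Q x = (\<Sum>j\<in>Q. x j *\<^sub>R column j A)"

definition cols_rank :: "real^'n^'m \<Rightarrow> 'n set \<Rightarrow> nat" where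
  "cols_rank A Q = dim ((\<lambda>j. column j A) ` Q)"

definition feas_sub :: "real^'n^'m \<Rightarrow> real^'m \<Rightarrow> 'n set \<Rightarrow> ('n \<Rightarrow> real) set" where
  "feas_sub A b Q = {x. cols_mult A Q x = b \<and> (\<forall>j\<in>Q. 0 \<le> x j)}"

definition val_sub :: "real^'n^'m \<Rightarrow> real^'m \<Rightarrow> real^'n \<Rightarrow> 'n set \<Rightarrow> ereal" where
  "val_sub A b c Q = opt_value (\<lambda>x. \<Sum>j\<in>Q. c $ j * x j) (feas_sub A b Q)"


subsection \<open>Bases, basic solutions and reduced costs\<close>

text \<open>For \<open>B\<close> with as many elements as there are rows, a fixed enumeration of \<open>B\<close> by the row
  index type makes \<open>A\<^sub>B\<close> a square matrix. Another enumeration only permutes the columns of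
  \<open>A\<^sub>B\<close>, the entries of \<open>c\<^sub>B\<close> and the rows of the inverse accordingly, so the notions
  \<open>is_basis\<close>, \<open>is_basic_solution\<close> and \<open>reduced_cost\<close> do not depend on the choice.\<close>

definition enum_of :: "'n set \<Rightarrow> 'm::finite \<Rightarrow> 'n::finite" where
  "enum_of B = (SOME e. bij_betw e UNIV B)"

definition basis_matrix :: "real^'n^'m \<Rightarrow> 'n set \<Rightarrow> real^'m^'m" where
  "basis_matrix A B = (\<chi> i k. A $ i $ enum_of B k)"

definition basis_cost :: "real^'n \<Rightarrow> 'n set \<Rightarrow> real^'m" where
  "basis_cost c B = (\<chi> k. c $ enum_of B k)"

definition is_basis :: "real^'n^'m \<Rightarrow> 'n set \<Rightarrow> bool" where
  "is_basis A B \<longleftrightarrow> card B = CARD('m) \<and> invertible (basis_matrix A B)"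

definition is_basic_solution ::
    "real^'n^'m \<Rightarrow> real^'m \<Rightarrow> 'n set \<Rightarrow> real^'n \<Rightarrow> bool" where
  "is_basic_solution A b B x \<longleftrightarrow>
     is_basis A B \<and>
     (\<chi> k. x $ enum_of B k) = matrix_inv (basis_matrix A B) *v b \<and>
     (\<forall>j. j \<notin> B \<longrightarrow> x $ j = 0)"

definition reduced_cost :: "real^'n^'m \<Rightarrow> real^'n \<Rightarrow> 'n set \<Rightarrow> real^'n" where
  "reduced_cost A c B =
     c - (basis_cost c B v* matrix_inv (basis_matrix A B)) v* A"


subsection \<open>Sampling without replacement\<close>

definition sample_wo_rep :: "nat \<Rightarrow> 'n::finite set pmf" where
  "sample_wo_rep K = pmf_of_set {Q. card Q = K}"

definition H_const :: "nat \<Rightarrow> nat \<Rightarrow> real" where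
  "H_const n K =
     (real n - 1 / 2) / (real n - real K) *
     (1 - 1 / (2 * max (real K) (real n - real K)))"

end

(*
  The bound holds for every sample Q, not only with probability at least 1 - delta.

  If P_Q had value above t, separating (b, t) from the cone generated by (0, 1) and the columns
  (a_j, c_j), j in Q, gives a y that is feasible for the dual of P_Q with y.b > t. Among such y,
  one with the largest number of tight constraints has tight columns spanning R^m, so it is the
  dual solution of a basis B contained in Q; the reduced cost vector r of B is nonnegative on Q.
  For x feasible for the distribution problem let z be n/K times the restriction of x to Q. As
  r.z >= 0, y.b - c.x = -r.x <= r.(z - x) <= chi |z - x|.

  The coordinates of z - x are x_j times n/K - 1 on Q and -1 off Q, and x_j <= C/n, so
  |z - x|^2 <= (C/n)^2 (K (n/K - 1)^2 + n - K) = C^2 (n - K) / (n K), whatever Q is.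
  Hence no concentration inequality is needed: the term with log(1/delta) is only nonnegative.
*)

theory Submission
  imports Defs
begin

section \<open>Linear programming duality: dual points and dual vertices\<close>

text \<open>A hyperplane separating \<open>(b, t)\<close> from the cone has a normal
  \<open>(u, r)\<close>. Primal feasibility excludes a vertical hyperplane, so \<open>r > 0\<close>,
  and \<open>- u / r\<close> is the dual point.\<close>

lemma farkas_value:
  fixes a :: "'i \<Rightarrow> 'v::euclidean_space" and c :: "'i \<Rightarrow> real"
  assumes "finite Q"
    and feas: "\<forall>j\<in>Q. 0 \<le> x0 j" "(\<Sum>j\<in>Q. x0 j *\<^sub>R a j) = b"
    and above: "\<And>x. \<forall>j\<in>Q. 0 \<le> x j \<Longrightarrow> (\<Sum>j\<in>Q. x j *\<^sub>R a j) = b \<Longrightarrow> t < (\<Sum>j\<in>Q. c j * x j)"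
  obtains y where "\<forall>j\<in>Q. y \<bullet> a j \<le> c j" "t < y \<bullet> b"
proof -
  define G where "G = insert (0, 1) ((\<lambda>j. (a j, c j)) ` Q)"
  \<comment> \<open>Explicit description of the cone over \<open>G\<close>: \<open>s\<close> is the
    coefficient of \<open>(0, 1)\<close>, so the last coordinate may be any number at or above the
    cost of \<open>x\<close>.\<close>
  define T where "T = {(\<Sum>j\<in>Q. x j *\<^sub>R a j, (\<Sum>j\<in>Q. c j * x j) + s) | x s. (\<forall>j\<in>Q. 0 \<le> x j) \<and> (0::real) \<le> s}"
  have TI: "p \<in> T" if "\<forall>j\<in>Q. 0 \<le> x j" "0 \<le> s" "p = (\<Sum>j\<in>Q. x j *\<^sub>R a j, (\<Sum>j\<in>Q. c j * x j) + s)" for p x s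
    using that unfolding T_def by blast
  have "G \<subseteq> T"
  proof -
    have "(0, 1) \<in> T" by (rule TI[where x = "\<lambda>_. 0" and s = 1]) auto
    moreover have "(a j, c j) \<in> T" if "j \<in> Q" for j
      by (rule TI[where x = "\<lambda>i. if i = j then 1 else 0" and s = 0])
        (use that \<open>finite Q\<close> in \<open>auto simp: if_distrib[where f = "\<lambda>r. r *\<^sub>R _"] if_distrib[where f = "\<lambda>r. _ * r"] cong: if_cong\<close>)
    ultimately show ?thesis unfolding G_def by auto
  qed
  moreover have "convex_cone T"
    unfolding convex_cone_iff
  proof (intro conjI ballI allI impI)
    show "0 \<in> T" by (rule TI[where x = "\<lambda>_. 0" and s = 0]) (auto simp: zero_prod_def)
  next
    fix p q assume "p \<in> T" "q \<in> T"
    then obtain x s x' s' where "\<forall>j\<in>Q. 0 \<le> x j" "0 \<le> s" "p = (\<Sum>j\<in>Q. x j *\<^sub>R a j, (\<Sum>j\<in>Q. c j * x j) + s)"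
      "\<forall>j\<in>Q. 0 \<le> x' j" "0 \<le> s'" "q = (\<Sum>j\<in>Q. x' j *\<^sub>R a j, (\<Sum>j\<in>Q. c j * x' j) + s')"
      unfolding T_def by blast
    then show "p + q \<in> T"
      by (intro TI[where x = "\<lambda>j. x j + x' j" and s = "s + s'"])
        (auto simp: algebra_simps sum.distrib)
  next
    fix p and r :: real assume "p \<in> T" "0 \<le> r"
    then obtain x s where "\<forall>j\<in>Q. 0 \<le> x j" "0 \<le> s" "p = (\<Sum>j\<in>Q. x j *\<^sub>R a j, (\<Sum>j\<in>Q. c j * x j) + s)"
      unfolding T_def by blast
    with \<open>0 \<le> r\<close> show "r *\<^sub>R p \<in> T"
      by (intro TI[where x = "\<lambda>j. r * x j" and s = "r * s"])
        (auto simp: algebra_simps scaleR_sum_right sum_distrib_left)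
  qed
  ultimately have "convex_cone hull G \<subseteq> T" by (rule hull_minimal)
  moreover have "(b, t) \<notin> T" using above unfolding T_def by force
  ultimately have "(b, t) \<notin> convex_cone hull G" by blast
  \<comment> \<open>A finitely generated cone is closed, which makes strict separation of a point
    available.\<close>
  moreover have "closed (convex_cone hull G)"
    by (rule closed_convex_cone_hull) (simp add: G_def \<open>finite Q\<close>)
  ultimately obtain w k where wk: "w \<bullet> (b, t) < k" "\<forall>p\<in>convex_cone hull G. k < w \<bullet> p"
    using separating_hyperplane_closed_point[OF convex_convex_cone_hull] by blast
  have "k < 0" using wk(2) convex_cone_hull_contains_0[of G] by force
  \<comment> \<open>If \<open>w\<close> were negative at \<open>p\<close>, the multiple of
    \<open>p\<close> by the positive factor \<open>k / (w \<bullet> p)\<close> would lie in the cone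
    and have value exactly \<open>k\<close>, while all values there exceed \<open>k\<close>.\<close>
  have pos: "0 \<le> w \<bullet> p" if "p \<in> G" for p
  proof (rule ccontr)
    assume neg: "\<not> 0 \<le> w \<bullet> p"
    have "(k / (w \<bullet> p)) *\<^sub>R p \<in> convex_cone hull G"
      using neg \<open>k < 0\<close> by (intro convex_cone_hull_mul hull_inc that) (simp add: divide_nonpos_neg)
    with wk(2) neg show False by force
  qed
  obtain u r where w: "w = (u, r)" by (cases w)
  have ur: "\<And>j. j \<in> Q \<Longrightarrow> 0 \<le> u \<bullet> a j + r * c j" "0 \<le> r" "u \<bullet> b + r * t < 0"
    using pos[of "(a _, c _)"] pos[of "(0, 1)"] wk(1) \<open>k < 0\<close> unfolding G_def w by auto
  \<comment> \<open>With \<open>r = 0\<close>, \<open>u\<close> is nonnegative on all columns, hence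
    on their nonnegative combination \<open>b\<close>, against
    \<open>u \<bullet> b < 0\<close>.\<close>
  have "r \<noteq> 0"
  proof
    assume "r = 0"
    have "u \<bullet> b = (\<Sum>j\<in>Q. x0 j * (u \<bullet> a j))"
      unfolding feas(2)[symmetric] by (simp add: inner_sum_right)
    also have "\<dots> \<ge> 0" using ur(1) feas(1) \<open>r = 0\<close> by (intro sum_nonneg) auto
    finally show False using ur(3) \<open>r = 0\<close> by simp
  qed
  with ur have "r > 0" by simp
  show ?thesis
  proof (rule that[of "(- 1 / r) *\<^sub>R u"])
    show "\<forall>j\<in>Q. ((- 1 / r) *\<^sub>R u) \<bullet> a j \<le> c j"
      using ur(1) \<open>r > 0\<close> by (force simp: field_simps)
    show "t < ((- 1 / r) *\<^sub>R u) \<bullet> b"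
      using ur(3) \<open>r > 0\<close> by (simp add: field_simps)
  qed
qed

text \<open>As long as the tight columns do not span, \<open>y\<close> can be moved orthogonally to
  them, without lowering \<open>y \<bullet> b\<close>, until a further constraint becomes tight. A
  point with the most tight constraints therefore has spanning tight columns.\<close>

lemma dual_vertex:
  fixes a :: "'i \<Rightarrow> 'v::euclidean_space" and c :: "'i \<Rightarrow> real"
  assumes "finite Q"
    and feas: "\<forall>j\<in>Q. 0 \<le> x0 j" "(\<Sum>j\<in>Q. x0 j *\<^sub>R a j) = b"
    and span: "span (a ` Q) = UNIV"
    and y0: "\<forall>j\<in>Q. y0 \<bullet> a j \<le> c j" "t < y0 \<bullet> b"
  obtains y where "\<forall>j\<in>Q. y \<bullet> a j \<le> c j" "t < y \<bullet> b" "span (a ` {j\<in>Q. y \<bullet> a j = c j}) = UNIV"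
proof -
  define P where "P y \<longleftrightarrow> (\<forall>j\<in>Q. y \<bullet> a j \<le> c j) \<and> t < y \<bullet> b" for y
  define tight where "tight y = {j\<in>Q. y \<bullet> a j = c j}" for y
  have "card (tight y) < Suc (card Q)" for y
    using \<open>finite Q\<close> by (simp add: tight_def card_mono le_imp_less_Suc)
  then obtain y where y: "P y" and max: "\<And>y'. P y' \<Longrightarrow> card (tight y') \<le> card (tight y)"
    using ex_has_greatest_nat[of P y0 "\<lambda>y. card (tight y)" "Suc (card Q)"] y0 unfolding P_def by auto
  have "span (a ` tight y) = UNIV"
  proof (rule ccontr)
    assume "span (a ` tight y) \<noteq> UNIV"
    then obtain d0 where d0: "d0 \<noteq> 0" "\<And>v. v \<in> span (a ` tight y) \<Longrightarrow> d0 \<bullet> v = 0"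
      using span_not_univ_subset_hyperplane[of "a ` tight y"] by auto
    have "\<exists>j\<in>Q. d0 \<bullet> a j \<noteq> 0"
    proof (rule ccontr)
      assume none: "\<not> ?thesis"
      have "d0 \<bullet> v = 0" if "v \<in> span (a ` Q)" for v
        by (rule span_induct[OF that subspace_hyperplane]) (use none in auto)
      then show False using span d0(1) by (metis UNIV_I inner_eq_zero_iff)
    qed
    then obtain i where i: "i \<in> Q" "d0 \<bullet> a i \<noteq> 0" by blast
    have db: "d \<bullet> b = (\<Sum>j\<in>Q. x0 j * (d \<bullet> a j))" for d
      unfolding feas(2)[symmetric] by (simp add: inner_sum_right)
    \<comment> \<open>The sign of \<open>d0\<close> is chosen. If \<open>d0 \<bullet> b = 0\<close>,
      either sign keeps the objective, so the one with \<open>d \<bullet> a i > 0\<close> is taken.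
      Otherwise the sign makes \<open>d \<bullet> b\<close> positive, and since \<open>b\<close> is
      a nonnegative combination of columns, some column has positive product with
      \<open>d\<close>.\<close>
    obtain d where d: "0 \<le> d \<bullet> b" "\<And>v. v \<in> span (a ` tight y) \<Longrightarrow> d \<bullet> v = 0" "\<exists>j\<in>Q. 0 < d \<bullet> a j"
    proof (cases "d0 \<bullet> b = 0")
      case True
      show ?thesis
        by (rule that[of "sgn (d0 \<bullet> a i) *\<^sub>R d0"])
          (use True d0 i in \<open>auto simp: sgn_if intro!: bexI[of _ i]\<close>)
    next
      case False
      define d where "d = sgn (d0 \<bullet> b) *\<^sub>R d0"
      have "0 < d \<bullet> b" using False by (auto simp: d_def sgn_if)
      moreover have "\<exists>j\<in>Q. 0 < d \<bullet> a j"
      proof (rule ccontr)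
        assume "\<not> ?thesis"
        then have "d \<bullet> b \<le> 0"
          unfolding db using feas(1) by (intro sum_nonpos mult_nonneg_nonpos) (auto simp: not_less)
        with \<open>0 < d \<bullet> b\<close> show False by simp
      qed
      ultimately show ?thesis using d0(2) by (intro that[of d]) (auto simp: d_def)
    qed
    \<comment> \<open>Ratio test: the constraints in \<open>J\<close> are those that a move along
      \<open>d\<close> uses up, and \<open>s j\<close> is the step length at which constraint
      \<open>j\<close> becomes tight. The shortest one, \<open>s k\<close>, preserves all of
      them.\<close>
    define J where "J = {j\<in>Q. 0 < d \<bullet> a j}"
    define s where "s j = (c j - y \<bullet> a j) / (d \<bullet> a j)" for j
    have "finite J" "J \<noteq> {}" using d(3) \<open>finite Q\<close> by (auto simp: J_def)
    then obtain k where k: "k \<in> J" "\<And>j. j \<in> J \<Longrightarrow> s k \<le> s j"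
      using arg_min_if_finite[of J s] by (metis not_le_imp_less)
    have sk: "0 \<le> s k" using k(1) y by (auto simp: s_def J_def P_def)
    define y' where "y' = y + s k *\<^sub>R d"
    have y'a: "y' \<bullet> a j = y \<bullet> a j + s k * (d \<bullet> a j)" for j
      by (simp add: y'_def inner_add_left)
    have "y' \<bullet> a j \<le> c j" if "j \<in> Q" for j
    proof (cases "j \<in> J")
      case True
      then show ?thesis using k(2)[OF True] by (simp add: y'a s_def J_def field_simps)
    next
      case False
      then have "s k * (d \<bullet> a j) \<le> 0"
        using sk that by (intro mult_nonneg_nonpos) (auto simp: J_def)
      then show ?thesis using y that by (force simp: P_def y'a)
    qed
    moreover have "t < y' \<bullet> b"
      using y sk d(1) by (auto simp: P_def y'_def inner_add_left add.commute[of "y \<bullet> b"] intro: add_strict_increasing2)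
    ultimately have "P y'" by (simp add: P_def)
    \<comment> \<open>Old tight constraints stay tight because \<open>d\<close> is orthogonal to
      their columns; \<open>k\<close> is new because \<open>d \<bullet> a k > 0\<close>.\<close>
    have tight0: "d \<bullet> a j = 0" if "j \<in> tight y" for j using that d(2) by (simp add: span_base)
    then have "tight y \<subseteq> tight y'" by (auto simp: tight_def y'a)
    moreover have "k \<in> tight y' - tight y"
      using k(1) tight0[of k] by (auto simp: tight_def y'a s_def J_def)
    ultimately have "card (tight y) < card (tight y')"
      using \<open>finite Q\<close> by (intro psubset_card_mono) (auto simp: tight_def)
    with max[OF \<open>P y'\<close>] show False by simp
  qed
  with y show ?thesis by (auto simp: P_def tight_def intro: that)
qed

section \<open>Bases, basic solutions and reduced costs\<close>

lemma bij_betw_enum_of: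
  fixes B :: "'n::finite set"
  assumes "card B = CARD('m::finite)"
  shows "bij_betw (enum_of B :: 'm \<Rightarrow> 'n) UNIV B"
proof -
  have "\<exists>e :: 'm \<Rightarrow> 'n. bij_betw e UNIV B"
    using assms by (intro finite_same_card_bij) auto
  then show ?thesis unfolding enum_of_def by (rule someI_ex)
qed

lemma column_basis_matrix: "column k (basis_matrix A B) = column (enum_of B k) A"
  by (simp add: column_def basis_matrix_def)

lemma vector_matrix_mult_column:
  fixes A :: "real^'n^'m"
  shows "(y v* A) $ j = y \<bullet> column j A"
  by (simp add: vector_matrix_mult_def column_def inner_vec_def mult.commute)

lemma spanning_columns_contain_basis:
  fixes A :: "real^'n^'m"
  assumes "span ((\<lambda>j. column j A) ` I) = UNIV"
  obtains B where "B \<subseteq> I" "is_basis A B"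
proof -
  obtain S where S: "S \<subseteq> (\<lambda>j. column j A) ` I" "independent S" "(\<lambda>j. column j A) ` I \<subseteq> span S"
    using maximal_independent_subset by blast
  have spanS: "span S = UNIV"
    using assms span_mono[OF S(3)] by (auto simp: span_span)
  \<comment> \<open>One index is picked for each column in \<open>S\<close>; distinct indices may
    carry equal columns.\<close>
  obtain B where B: "B \<subseteq> I" "inj_on (\<lambda>j. column j A) B" "S = (\<lambda>j. column j A) ` B"
    using S(1) subset_image_inj by metis
  have "card S = CARD('m)"
    using dim_eq_card[OF _ S(2), of UNIV] spanS by simp
  then have card: "card B = CARD('m)" using B by (simp add: card_image)
  have "range (enum_of B :: 'm \<Rightarrow> 'n) = B"
    using bij_betw_enum_of[OF card] by (simp add: bij_betw_def)
  moreover have "columns (basis_matrix A B) = (\<lambda>j. column j A) ` range (enum_of B :: 'm \<Rightarrow> 'n)"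
    by (auto simp: columns_def column_basis_matrix)
  ultimately have "columns (basis_matrix A B) = S"
    using B(3) by simp
  then have "invertible (basis_matrix A B)"
    using spanS by (simp add: invertible_right_inverse matrix_right_invertible_span_columns span_vec_eq)
  with B(1) card show ?thesis by (intro that) (auto simp: is_basis_def)
qed

text \<open>The bound \<open>chi\<close> is assumed for bases that come with a basic solution; this
  makes it apply to every basis.\<close>

lemma is_basis_has_basic_solution:
  fixes A :: "real^'n^'m"
  assumes "is_basis A B"
  obtains x where "is_basic_solution A b B x"
proof -
  let ?e = "enum_of B :: 'm \<Rightarrow> 'n"
  have e: "bij_betw ?e UNIV B"
    using assms by (intro bij_betw_enum_of) (simp add: is_basis_def)
  show ?thesis
    by (rule that[of "\<chi> j. if j \<in> B then (matrix_inv (basis_matrix A B) *v b) $ inv ?e j else 0"])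
      (use assms e in \<open>auto simp: is_basic_solution_def vec_eq_iff bij_betw_def\<close>)
qed

text \<open>The tight equations over \<open>B\<close> say that \<open>y\<close> times the basis
  matrix is the basis cost, so \<open>y\<close> is the dual solution of \<open>B\<close>.\<close>

lemma reduced_cost_tight:
  fixes A :: "real^'n^'m"
  assumes "is_basis A B" and tight: "\<And>j. j \<in> B \<Longrightarrow> y \<bullet> column j A = c $ j"
  shows "reduced_cost A c B = c - y v* A"
proof -
  let ?M = "basis_matrix A B"
  have e: "bij_betw (enum_of B :: 'm \<Rightarrow> 'n) UNIV B"
    using assms by (intro bij_betw_enum_of) (simp add: is_basis_def)
  have "enum_of B k \<in> B" for k :: 'm
    using e by (auto simp: bij_betw_def)
  then have "basis_cost c B = y v* ?M"
    by (simp add: vec_eq_iff basis_cost_def vector_matrix_mult_column column_basis_matrix tight)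
  moreover have "?M ** matrix_inv ?M = mat 1"
    using assms(1) unfolding is_basis_def invertible_def matrix_inv_def by (metis (mono_tags, lifting) someI_ex)
  ultimately show ?thesis by (simp add: reduced_cost_def vector_matrix_mul_assoc)
qed

section \<open>The rescaled sample and the bound for a fixed sample\<close>

lemma norm_sample_deviation_le:
  fixes x :: "real^'n" and Q :: "'n set"
  assumes K: "card Q = K" "1 \<le> K"
    and x: "\<And>j. 0 \<le> x $ j" "\<And>j. x $ j \<le> C / real CARD('n)"
  shows "norm (\<chi> j. (if j \<in> Q then CARD('n) / K else 0) * x $ j - x $ j)
           \<le> C / sqrt K * sqrt ((CARD('n) - real K) / CARD('n))"
proof (rule power2_le_imp_le)
  let ?n = "real CARD('n)"
  have n: "?n > 0" and "K \<le> CARD('n)" using card_mono[of UNIV Q] K by auto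
  have "0 \<le> C / ?n" using x order_trans by blast
  then have "0 \<le> C" using n by (simp add: zero_le_divide_iff)
  \<comment> \<open>Once each \<open>x $ j\<close> is bounded by \<open>C / n\<close>, only the
    weights \<open>g\<close> remain, and the sum of their squares depends on \<open>Q\<close> only
    through its size.\<close>
  define g where "g j = (if j \<in> Q then ?n / K else 0) - 1" for j
  have "(norm (\<chi> j. (if j \<in> Q then ?n / K else 0) * x $ j - x $ j))\<^sup>2 = (\<Sum>j\<in>UNIV. (g j)\<^sup>2 * (x $ j)\<^sup>2)"
    unfolding power2_norm_eq_inner inner_vec_def
    by (simp add: g_def power2_eq_square algebra_simps)
  also have "\<dots> \<le> (\<Sum>j\<in>UNIV. (g j)\<^sup>2 * (C / ?n)\<^sup>2)"
    using x by (intro sum_mono mult_left_mono power_mono) auto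
  also have "\<dots> = (\<Sum>j\<in>UNIV. (g j)\<^sup>2) * (C / ?n)\<^sup>2"
    by (simp add: sum_distrib_right)
  also have "(\<Sum>j\<in>UNIV. (g j)\<^sup>2) = (\<Sum>j\<in>Q. (g j)\<^sup>2) + (\<Sum>j\<in>-Q. (g j)\<^sup>2)"
    by (subst sum.union_disjoint[symmetric]) auto
  also have "\<dots> = K * (?n / K - 1)\<^sup>2 + (?n - K)"
    using K \<open>K \<le> CARD('n)\<close> by (simp add: g_def Compl_eq_Diff_UNIV card_Diff_subset of_nat_diff)
  \<comment> \<open>The sum of squares simplifies to \<open>n * (n - K) / K\<close>.\<close>
  also have "\<dots> * (C / ?n)\<^sup>2 = (C / sqrt K * sqrt ((?n - real K) / ?n))\<^sup>2"
    using n K \<open>K \<le> CARD('n)\<close> by (simp add: power_mult_distrib power_divide) (simp add: field_simps power2_eq_square)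
  finally show "(norm (\<chi> j. (if j \<in> Q then ?n / K else 0) * x $ j - x $ j))\<^sup>2
      \<le> (C / sqrt K * sqrt ((?n - real K) / ?n))\<^sup>2" .
  show "0 \<le> C / sqrt K * sqrt ((?n - real K) / ?n)"
    using \<open>0 \<le> C\<close> \<open>K \<le> CARD('n)\<close> by simp
qed

lemma val_sub_le:
  fixes A :: "real^'n^'m" and Q :: "'n set"
  assumes chi_bound: "\<And>B x. is_basic_solution A b B x \<Longrightarrow> norm (reduced_cost A c B) \<le> chi"
    and K: "card Q = K" "1 \<le> K"
    and Q: "feas_sub A b Q \<noteq> {}" "cols_rank A Q = CARD('m)"
    and x: "x \<in> feas_distr A b C"
  shows "val_sub A b c Q \<le> ereal (c \<bullet> x + C / sqrt K * chi * sqrt ((CARD('n) - real K) / CARD('n)))"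
    (is "_ \<le> ereal (_ + ?R)")
proof (rule ccontr)
  let ?a = "\<lambda>j. column j A"
  assume "\<not> ?thesis"
  then have "ereal (c \<bullet> x + ?R) < val_sub A b c Q" by simp
  \<comment> \<open>A bound below the infimum is strictly below each feasible cost, the form that
    \<open>farkas_value\<close> takes.\<close>
  then have above: "c \<bullet> x + ?R < (\<Sum>j\<in>Q. c $ j * x' j)"
    if "\<forall>j\<in>Q. 0 \<le> x' j" "(\<Sum>j\<in>Q. x' j *\<^sub>R ?a j) = b" for x'
    using that unfolding val_sub_def opt_value_def
    by (auto simp: feas_sub_def cols_mult_def dest!: less_INF_D[where i = x'])
  obtain x0 where x0: "\<forall>j\<in>Q. 0 \<le> x0 j" "(\<Sum>j\<in>Q. x0 j *\<^sub>R ?a j) = b"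
    using Q(1) by (auto simp: feas_sub_def cols_mult_def)
  have span: "span (?a ` Q) = UNIV"
    using Q(2) dim_eq_full[of "?a ` Q"] by (simp add: cols_rank_def)
  obtain y0 where "\<forall>j\<in>Q. y0 \<bullet> ?a j \<le> c $ j" "c \<bullet> x + ?R < y0 \<bullet> b"
    using farkas_value[of Q x0 ?a b "c \<bullet> x + ?R" "\<lambda>j. c $ j"] x0 above by auto
  then obtain y where y: "\<forall>j\<in>Q. y \<bullet> ?a j \<le> c $ j" "c \<bullet> x + ?R < y \<bullet> b"
    "span (?a ` {j\<in>Q. y \<bullet> ?a j = c $ j}) = UNIV"
    using dual_vertex[of Q x0 ?a b y0 "\<lambda>j. c $ j" "c \<bullet> x + ?R"] x0 span by auto
  obtain B where B: "B \<subseteq> {j\<in>Q. y \<bullet> ?a j = c $ j}" "is_basis A B"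
    using spanning_columns_contain_basis[OF y(3)] by blast
  define r where "r = reduced_cost A c B"
  have r: "r = c - y v* A"
    unfolding r_def using B by (intro reduced_cost_tight) auto
  have "norm r \<le> chi"
    using is_basis_has_basic_solution[OF B(2)] chi_bound unfolding r_def by metis
  define z where "z = (\<chi> j. (if j \<in> Q then CARD('n) / K else 0) * x $ j)"
  \<comment> \<open>\<open>z\<close> is nonnegative and vanishes off \<open>Q\<close>, while dual
    feasibility of \<open>y\<close> makes \<open>r\<close> nonnegative on \<open>Q\<close>.\<close>
  have "0 \<le> r \<bullet> z"
    unfolding inner_vec_def z_def
    using y(1) x by (auto intro!: sum_nonneg simp: r vector_matrix_mult_column feas_distr_def)
  \<comment> \<open>Here \<open>A *v x = b\<close> turns \<open>y \<bullet> b\<close> into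
    \<open>(y v* A) \<bullet> x\<close>.\<close>
  have "y \<bullet> b - c \<bullet> x = - (r \<bullet> x)"
    using x by (auto simp: r inner_diff_left dot_lmul_matrix feas_distr_def)
  also have "\<dots> \<le> r \<bullet> (z - x)" using \<open>0 \<le> r \<bullet> z\<close> by (simp add: inner_diff_right)
  also have "\<dots> \<le> norm r * norm (z - x)" by (rule norm_cauchy_schwarz)
  also have "\<dots> \<le> chi * (C / sqrt K * sqrt ((CARD('n) - real K) / CARD('n)))"
  proof (rule mult_mono[OF \<open>norm r \<le> chi\<close>])
    have "z - x = (\<chi> j. (if j \<in> Q then CARD('n) / K else 0) * x $ j - x $ j)"
      by (simp add: z_def vec_eq_iff)
    then show "norm (z - x) \<le> C / sqrt K * sqrt ((CARD('n) - real K) / CARD('n))"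
      using norm_sample_deviation_le[OF K, of x C] x by (auto simp: feas_distr_def)
    show "0 \<le> chi" using \<open>norm r \<le> chi\<close> norm_ge_zero order_trans by blast
  qed simp
  finally show False using y(2) by (simp add: mult_ac)
qed

section \<open>From fixed samples to the probability statement\<close>

text \<open>The maximum is at least 1, so the second factor is at least 1/2. This makes the term
  with \<open>ln (1 / \<delta>)\<close> nonnegative.\<close>

lemma H_const_nonneg:
  assumes "1 \<le> K" "K < n"
  shows "0 \<le> H_const n K"
proof -
  have "1 \<le> max (real K) (real n - real K)" using assms by simp
  then have "1 / (2 * max (real K) (real n - real K)) \<le> 1" by (simp add: field_simps)
  with assms show ?thesis by (auto simp: H_const_def)
qed

theorem mainTheorem14:
  fixes A :: "real^'n^'m" and b :: "real^'m" and c :: "real^'n"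
    and C chi \<delta> :: real and K :: nat
  assumes feasible: "feas A b \<noteq> {}"
    and bounded: "bdd_below ((\<lambda>x. c \<bullet> x) ` feas A b)"
    and full_rank: "rank A = CARD('m)"
    and norm_c: "norm c = 1"
    and C: "0 \<le> C"
    and K: "1 \<le> K" "K < CARD('n)"
    and chi_bound: "\<And>B x. is_basic_solution A b B x \<Longrightarrow> norm (reduced_cost A c B) \<le> chi"
    and delta: "0 < \<delta>" "\<delta> < 1"
  shows "measure_pmf.prob (sample_wo_rep K)
      {Q :: 'n set. feas_sub A b Q \<noteq> {} \<and> cols_rank A Q = CARD('m) \<longrightarrow>
         val_sub A b c Q - val A b c
           \<le> (val_distr A b c C - val A b c)
             + ereal (C / sqrt (real K) * chi *
                 (sqrt ((real CARD('n) - real K) / (real CARD('n) - 1))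
                  + sqrt (2 / H_const CARD('n) K * ln (1 / \<delta>))))}
    \<ge> 1 - \<delta>"
proof -
  let ?n = "real CARD('n)"
  let ?R = "C / sqrt (real K) * chi *
                 (sqrt ((?n - real K) / (?n - 1))
                  + sqrt (2 / H_const CARD('n) K * ln (1 / \<delta>)))"
  let ?E = "{Q :: 'n set. feas_sub A b Q \<noteq> {} \<and> cols_rank A Q = CARD('m) \<longrightarrow>
         val_sub A b c Q - val A b c \<le> (val_distr A b c C - val A b c) + ereal ?R}"
  have "span ((\<lambda>j. column j A) ` UNIV) = UNIV"
    using full_rank dim_eq_full[of "columns A"]
    by (simp add: column_rank_def columns_def full_SetCompr_eq)
  \<comment> \<open>Full rank provides some basis, and a norm bounded by \<open>chi\<close> shows
    \<open>0 \<le> chi\<close>.\<close>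
  then obtain B x where "is_basic_solution A b B x"
    using spanning_columns_contain_basis is_basis_has_basic_solution by metis
  then have chi: "0 \<le> chi" using chi_bound norm_ge_zero order_trans by blast
  have slack: "C / sqrt K * chi * sqrt ((?n - real K) / ?n) \<le> ?R"
  proof (intro mult_left_mono)
    \<comment> \<open>The denominator decreases from \<open>n\<close> to \<open>n - 1\<close>, which
      is positive since \<open>1 \<le> K < n\<close>.\<close>
    have "(?n - real K) / ?n \<le> (?n - real K) / (?n - 1)"
      using K by (intro divide_left_mono) auto
    moreover have "0 \<le> 2 / H_const CARD('n) K * ln (1 / \<delta>)"
      using H_const_nonneg[OF K] delta by (intro mult_nonneg_nonneg) auto
    ultimately show "sqrt ((?n - real K) / ?n)
        \<le> sqrt ((?n - real K) / (?n - 1)) + sqrt (2 / H_const CARD('n) K * ln (1 / \<delta>))"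
      by (intro add_increasing2 real_sqrt_le_mono real_sqrt_ge_zero)
  qed (use C chi in simp)
  \<comment> \<open>Feasibility and boundedness make the optimal value a real number, so it cancels
    in the extended real inequality.\<close>
  have "val A b c < \<infinity>"
    using feasible by (force simp: val_def opt_value_def INF_less_iff simp del: ereal_infty_less)
  moreover obtain l where "\<forall>x\<in>feas A b. l \<le> c \<bullet> x"
    using bounded by (auto simp: bdd_below_def)
  then have "ereal l \<le> val A b c"
    unfolding val_def opt_value_def by (intro INF_greatest) auto
  ultimately obtain v where v: "val A b c = ereal v" by (cases "val A b c") auto
  have "Q \<in> ?E" if card: "card Q = K" for Q
  proof (intro CollectI impI, elim conjE)
    assume Q: "feas_sub A b Q \<noteq> {}" "cols_rank A Q = CARD('m)"
    \<comment> \<open>With \<open>?R\<close> on the left, the claim bounds an infimum from below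
      pointwise; this includes an infeasible distribution problem, whose value is
      \<open>\<infinity>\<close>.\<close>
    have "val_sub A b c Q - ereal ?R \<le> val_distr A b c C"
      unfolding val_distr_def opt_value_def
    proof (rule INF_greatest)
      fix x assume "x \<in> feas_distr A b C"
      then have "val_sub A b c Q \<le> ereal (c \<bullet> x + C / sqrt K * chi * sqrt ((?n - real K) / ?n))"
        by (intro val_sub_le[OF chi_bound card K(1) Q])
      also have "\<dots> \<le> ereal (c \<bullet> x + ?R)" using slack by simp
      finally show "val_sub A b c Q - ereal ?R \<le> ereal (c \<bullet> x)"
        by (cases "val_sub A b c Q") auto
    qed
    then show "val_sub A b c Q - val A b c \<le> (val_distr A b c C - val A b c) + ereal ?R"
      unfolding v by (cases "val_sub A b c Q"; cases "val_distr A b c C") auto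
  qed
  \<comment> \<open>The uniform distribution has the intended support only over a nonempty finite
    set.\<close>
  moreover have "\<exists>Q :: 'n set. card Q = K"
    using K obtain_subset_with_card_n[of K "UNIV :: 'n set"] by auto
  then have "set_pmf (sample_wo_rep K :: 'n set pmf) = {Q. card Q = K}"
    unfolding sample_wo_rep_def by (intro set_pmf_of_set) auto
  ultimately have "measure_pmf.prob (sample_wo_rep K) ?E = 1"
    by (intro measure_pmf.prob_eq_1[THEN iffD2]) (auto simp: AE_measure_pmf_iff)
  then show ?thesis using delta by simp
qed

end
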